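(* Let $n\in\mathbb{N}$ and let $X$ be a diffeological space containing $\mathbb{R}^{\ge0}\times\mathbb{R}^n$, with the sub-diffeology of $\mathbb{R}^{n+1}$, as a $D$-open subset (i.e. some $D$-open subset of $X$ with its sub-diffeology is diffeomorphic to $\mathbb{R}^{\ge0}\times\mathbb{R}^n$). Then $X$ is not fibrant. In particular, any smooth manifold with (non-empty) boundary or with corners is not fibrant.
   Context: A diffeological space is a set $X$ together with, for each $n\in\mathbb{N}$ and each open $U\subseteq\mathbb{R}^n$, a specified set of functions $U\to X$ called plots, such that: every constant map is a plot; if $U\to X$ is a plot and $V\to U$ is a smooth map between open subsets of Euclidean spaces then the composite $V\to X$ is a plot; and a function $U\to X$ whose restriction to each member of some open cover of $U$ is a plot is itself a plot. A map $f:X\to Y$ is smooth if $f\circ p$ is a plot of $Y$ for every plot $p$ of $X$; $C^\infty(X,Y)$ is the set of smooth maps; a diffeomorphism is an isomorphism in the resulting category. Manifolds (possibly with boundary or corners) have as plots the usual smooth maps from open subsets of Euclidean spaces. A subset $A\subseteq X$ has the sub-diffeology: $U\to A$ is a plot iff $U\to A\hookrightarrow X$ is. The $D$-topology on $X$ is the final topology induced by its plots; a $D$-open subset is a subset open in this topology. Here $\mathbb{R}^{\ge0}=[0,\infty)$. Let $\mathbb{A}^n=\{(x_0,\dots,x_n)\in\mathbb{R}^{n+1}\mid\sum x_i=1\}$ with the sub-diffeology from $\mathbb{R}^{n+1}$. A map $f:\{0,\dots,n\}\to\{0,\dots,m\}$ in the simplicial category induces $f_*:\mathbb{A}^n\to\mathbb{A}^m$,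 $f_*(x)_j=\sum_{i\in f^{-1}(j)}x_i$. $S^D(X)$ is the simplicial set with $S^D_n(X)=C^\infty(\mathbb{A}^n,X)$ and structure maps given by precomposition. A diffeological space $X$ is fibrant if $S^D(X)$ is a Kan complex. *)

theory Defs
  imports "HOL-Analysis.Analysis"
begin

section \<open>Smooth maps between subsets of Euclidean spaces\<close>

text \<open>
  The dimension is a bound variable in the definition of a diffeology, so \<open>\<real>\<^sup>n\<close> is the library space
  \<^const>\<open>Euclidean_space\<close>: the sequences vanishing from index \<open>n\<close> on, with coordinates \<open>0, \<dots>, n - 1\<close>.
\<close>

definition partial_deriv :: "nat \<Rightarrow> ((nat \<Rightarrow> real) \<Rightarrow> real) \<Rightarrow> (nat \<Rightarrow> real) \<Rightarrow> real" where
  "partial_deriv i f x = deriv (\<lambda>t. f (x(i := t))) (x i)"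

primrec Ck_on :: "nat \<Rightarrow> nat \<Rightarrow> (nat \<Rightarrow> real) set \<Rightarrow> ((nat \<Rightarrow> real) \<Rightarrow> real) \<Rightarrow> bool" where
  "Ck_on 0 n U f \<longleftrightarrow> continuous_map (subtopology (Euclidean_space n) U) euclideanreal f"
| "Ck_on (Suc k) n U f \<longleftrightarrow>
     continuous_map (subtopology (Euclidean_space n) U) euclideanreal f \<and>
     (\<forall>i<n. (\<forall>x\<in>U. (\<lambda>t. f (x(i := t))) differentiable (at (x i))) \<and>
            Ck_on k n U (partial_deriv i f))"

text \<open>Meaningful for \<open>U\<close> open in \<open>\<real>\<^sup>m\<close>; only the values of \<open>f\<close> on \<open>U\<close> matter.\<close>

definition smooth_map :: "nat \<Rightarrow> (nat \<Rightarrow> real) set \<Rightarrow> nat \<Rightarrow> ((nat \<Rightarrow> real) \<Rightarrow> (nat \<Rightarrow> real)) \<Rightarrow> bool" where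
  "smooth_map m U n f \<longleftrightarrow>
     f ` U \<subseteq> topspace (Euclidean_space n) \<and> (\<forall>j<n. \<forall>k. Ck_on k m U (\<lambda>x. f x j))"

text \<open>Smoothness on an arbitrary subset of \<open>\<real>\<^sup>m\<close>: local extendability to smooth maps on open sets.\<close>

definition smooth_map_on_subset ::
    "nat \<Rightarrow> (nat \<Rightarrow> real) set \<Rightarrow> nat \<Rightarrow> ((nat \<Rightarrow> real) \<Rightarrow> (nat \<Rightarrow> real)) \<Rightarrow> bool" where
  "smooth_map_on_subset m A n f \<longleftrightarrow>
     (\<forall>x\<in>A. \<exists>U g. openin (Euclidean_space m) U \<and> x \<in> U \<and> smooth_map m U n g \<and>
                   (\<forall>y \<in> U \<inter> A. g y = f y))"


section \<open>Diffeological spaces\<close>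

text \<open>
  Functions \<open>U \<rightarrow> X\<close> are extensional (\<open>\<rightarrow>\<^sub>E\<close>), i.e. \<^const>\<open>undefined\<close> outside their domain. The plots
  component is only consulted at sets \<open>U\<close> that are open in \<open>\<real>\<^sup>n\<close>.
\<close>

record 'a diff_space =
  carrier :: "'a set"
  plots :: "nat \<Rightarrow> (nat \<Rightarrow> real) set \<Rightarrow> ((nat \<Rightarrow> real) \<Rightarrow> 'a) set"

definition diffeological_space :: "'a diff_space \<Rightarrow> bool" where
  "diffeological_space X \<longleftrightarrow>
     (\<forall>n U. openin (Euclidean_space n) U \<longrightarrow> plots X n U \<subseteq> U \<rightarrow>\<^sub>E carrier X) \<and>
     (\<forall>n U. \<forall>x\<in>carrier X. openin (Euclidean_space n) U \<longrightarrow> (\<lambda>u\<in>U. x) \<in> plots X n U) \<and>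
     (\<forall>n U m V f. \<forall>p\<in>plots X n U.
        openin (Euclidean_space n) U \<and> openin (Euclidean_space m) V \<and>
        f ` V \<subseteq> U \<and> smooth_map m V n f \<longrightarrow> compose V p f \<in> plots X m V) \<and>
     (\<forall>n U \<U>. \<forall>p \<in> U \<rightarrow>\<^sub>E carrier X.
        openin (Euclidean_space n) U \<and> (\<forall>V\<in>\<U>. openin (Euclidean_space n) V) \<and> \<Union>\<U> = U \<and>
        (\<forall>V\<in>\<U>. restrict p V \<in> plots X n V) \<longrightarrow> p \<in> plots X n U)"

definition smooth_maps :: "'a diff_space \<Rightarrow> 'b diff_space \<Rightarrow> ('a \<Rightarrow> 'b) set" where
  "smooth_maps X Y =
     {f \<in> carrier X \<rightarrow>\<^sub>E carrier Y.
        \<forall>n U. \<forall>p\<in>plots X n U. openin (Euclidean_space n) U \<longrightarrow> compose U f p \<in> plots Y n U}"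

definition diffeomorphic :: "'a diff_space \<Rightarrow> 'b diff_space \<Rightarrow> bool" where
  "diffeomorphic X Y \<longleftrightarrow>
     (\<exists>f \<in> smooth_maps X Y. \<exists>g \<in> smooth_maps Y X.
        compose (carrier X) g f = (\<lambda>x\<in>carrier X. x) \<and>
        compose (carrier Y) f g = (\<lambda>y\<in>carrier Y. y))"

definition sub_diffeology :: "'a diff_space \<Rightarrow> 'a set \<Rightarrow> 'a diff_space" where
  "sub_diffeology X A =
     \<lparr>carrier = A, plots = (\<lambda>n U. {p \<in> U \<rightarrow>\<^sub>E A. p \<in> plots X n U})\<rparr>"

definition D_topology :: "'a diff_space \<Rightarrow> 'a topology" where
  "D_topology X =
     topology (\<lambda>A. A \<subseteq> carrier X \<and>
       (\<forall>n U. \<forall>p\<in>plots X n U.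
          openin (Euclidean_space n) U \<longrightarrow> openin (Euclidean_space n) {u\<in>U. p u \<in> A}))"

definition euclidean_diff :: "nat \<Rightarrow> (nat \<Rightarrow> real) diff_space" where
  "euclidean_diff n =
     \<lparr>carrier = topspace (Euclidean_space n),
      plots = (\<lambda>m U. {p \<in> U \<rightarrow>\<^sub>E topspace (Euclidean_space n). smooth_map m U n p})\<rparr>"

definition half_space :: "nat \<Rightarrow> (nat \<Rightarrow> real) diff_space" where
  "half_space n =
     sub_diffeology (euclidean_diff (n + 1)) {x \<in> topspace (Euclidean_space (n + 1)). x 0 \<ge> 0}"


section \<open>Simplicial sets and Kan complexes\<close>

definition simplicial_ops :: "nat \<Rightarrow> nat \<Rightarrow> (nat \<Rightarrow> nat) set" where
  "simplicial_ops m n = {\<theta> \<in> {..m} \<rightarrow>\<^sub>E {..n}. mono_on {..m} \<theta>}"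

text \<open>For \<open>\<theta> : [m] \<rightarrow> [n]\<close>, \<open>act S m n \<theta>\<close> is the structure map \<open>S\<^sub>n \<rightarrow> S\<^sub>m\<close>.\<close>

record 's sset =
  simplices :: "nat \<Rightarrow> 's set"
  act :: "nat \<Rightarrow> nat \<Rightarrow> (nat \<Rightarrow> nat) \<Rightarrow> 's \<Rightarrow> 's"

definition simplicial_set :: "'s sset \<Rightarrow> bool" where
  "simplicial_set S \<longleftrightarrow>
     (\<forall>m n. \<forall>\<theta>\<in>simplicial_ops m n. \<forall>x\<in>simplices S n. act S m n \<theta> x \<in> simplices S m) \<and>
     (\<forall>n. \<forall>x\<in>simplices S n. act S n n (\<lambda>i\<in>{..n}. i) x = x) \<and>
     (\<forall>l m n. \<forall>\<eta>\<in>simplicial_ops l m. \<forall>\<theta>\<in>simplicial_ops m n. \<forall>x\<in>simplices S n.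
        act S l m \<eta> (act S m n \<theta> x) = act S l n (compose {..l} \<theta> \<eta>) x)"

definition simplicial_map :: "'s sset \<Rightarrow> 't sset \<Rightarrow> (nat \<Rightarrow> 's \<Rightarrow> 't) \<Rightarrow> bool" where
  "simplicial_map S T \<tau> \<longleftrightarrow>
     (\<forall>m. \<forall>x\<in>simplices S m. \<tau> m x \<in> simplices T m) \<and>
     (\<forall>m n. \<forall>\<theta>\<in>simplicial_ops m n. \<forall>x\<in>simplices S n.
        \<tau> m (act S m n \<theta> x) = act T m n \<theta> (\<tau> n x))"

definition standard_simplex_sset :: "nat \<Rightarrow> (nat \<Rightarrow> nat) sset" where
  "standard_simplex_sset n =
     \<lparr>simplices = (\<lambda>m. simplicial_ops m n), act = (\<lambda>l m \<eta> \<theta>. compose {..l} \<theta> \<eta>)\<rparr>"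

text \<open>The horn \<open>\<Lambda>\<^sup>n\<^sub>k\<close> is the union of the faces of \<open>\<Delta>\<^sup>n\<close> opposite to the vertices \<open>i \<noteq> k\<close>.\<close>

definition horn :: "nat \<Rightarrow> nat \<Rightarrow> (nat \<Rightarrow> nat) sset" where
  "horn n k =
     \<lparr>simplices = (\<lambda>m. {\<theta> \<in> simplicial_ops m n. \<exists>i\<le>n. i \<noteq> k \<and> i \<notin> \<theta> ` {..m}}),
      act = (\<lambda>l m \<eta> \<theta>. compose {..l} \<theta> \<eta>)\<rparr>"

definition kan_complex :: "'s sset \<Rightarrow> bool" where
  "kan_complex S \<longleftrightarrow> simplicial_set S \<and>
     (\<forall>n\<ge>1. \<forall>k\<le>n. \<forall>\<sigma>. simplicial_map (horn n k) S \<sigma> \<longrightarrow>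
        (\<exists>\<tau>. simplicial_map (standard_simplex_sset n) S \<tau> \<and>
             (\<forall>m. \<forall>\<theta>\<in>simplices (horn n k) m. \<tau> m \<theta> = \<sigma> m \<theta>)))"


section \<open>The smooth singular complex\<close>

definition affine_simplex :: "nat \<Rightarrow> (nat \<Rightarrow> real) diff_space" where
  "affine_simplex n =
     sub_diffeology (euclidean_diff (n + 1))
       {x \<in> topspace (Euclidean_space (n + 1)). (\<Sum>i\<le>n. x i) = 1}"

definition affine_push :: "nat \<Rightarrow> (nat \<Rightarrow> nat) \<Rightarrow> (nat \<Rightarrow> real) \<Rightarrow> (nat \<Rightarrow> real)" where
  "affine_push n \<theta> x = (\<lambda>j. \<Sum>i\<in>{i\<in>{..n}. \<theta> i = j}. x i)"

definition smooth_singular :: "'a diff_space \<Rightarrow> ((nat \<Rightarrow> real) \<Rightarrow> 'a) sset" where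
  "smooth_singular X =
     \<lparr>simplices = (\<lambda>n. smooth_maps (affine_simplex n) X),
      act = (\<lambda>m n \<theta> \<sigma>. compose (carrier (affine_simplex m)) \<sigma> (affine_push m \<theta>))\<rparr>"

definition fibrant :: "'a diff_space \<Rightarrow> bool" where
  "fibrant X \<longleftrightarrow> kan_complex (smooth_singular X)"


section \<open>Manifolds with boundary or corners\<close>

definition sector :: "nat \<Rightarrow> nat \<Rightarrow> (nat \<Rightarrow> real) set" where
  "sector d k = {x \<in> topspace (Euclidean_space d). \<forall>i<k. x i \<ge> 0}"

text \<open>
  A chart \<open>(k, V, \<phi>)\<close> is a homeomorphism \<open>\<phi>\<close> from an open set \<open>V\<close> onto a relatively open subset of
  \<open>[0, \<infinity>)\<^sup>k \<times> \<real>\<^sup>d\<^sup>-\<^sup>k\<close>. As \<open>k\<close> may vary with the chart, the usual conventions for the local models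
  (all \<open>k\<close> equal to \<open>d\<close>, or arbitrary \<open>k \<le> d\<close>) are all covered.
\<close>

type_synonym 'a chart = "nat \<times> 'a set \<times> ('a \<Rightarrow> nat \<Rightarrow> real)"

definition corner_chart :: "nat \<Rightarrow> 'a topology \<Rightarrow> 'a chart \<Rightarrow> bool" where
  "corner_chart d T = (\<lambda>(k, V, \<phi>).
     k \<le> d \<and> openin T V \<and>
     openin (subtopology (Euclidean_space d) (sector d k)) (\<phi> ` V) \<and>
     homeomorphic_map (subtopology T V) (subtopology (Euclidean_space d) (\<phi> ` V)) \<phi>)"

definition smooth_manifold_with_corners :: "nat \<Rightarrow> 'a topology \<Rightarrow> 'a chart set \<Rightarrow> bool" where
  "smooth_manifold_with_corners d T \<A> \<longleftrightarrow>
     Hausdorff_space T \<and> second_countable T \<and>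
     (\<forall>c\<in>\<A>. corner_chart d T c) \<and>
     (\<Union>(k, V, \<phi>)\<in>\<A>. V) = topspace T \<and>
     (\<forall>(k, V, \<phi>)\<in>\<A>. \<forall>(l, W, \<psi>)\<in>\<A>.
        smooth_map_on_subset d (\<phi> ` (V \<inter> W)) d (\<lambda>y. \<psi> (inv_into V \<phi> y)))"

definition smooth_manifold_with_boundary :: "nat \<Rightarrow> 'a topology \<Rightarrow> 'a chart set \<Rightarrow> bool" where
  "smooth_manifold_with_boundary d T \<A> \<longleftrightarrow>
     smooth_manifold_with_corners d T \<A> \<and> (\<forall>(k, V, \<phi>)\<in>\<A>. k \<le> 1)"

definition manifold_boundary :: "'a chart set \<Rightarrow> 'a set" where
  "manifold_boundary \<A> = {x. \<exists>(k, V, \<phi>)\<in>\<A>. x \<in> V \<and> (\<exists>i<k. \<phi> x i = 0)}"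

definition manifold_diff :: "nat \<Rightarrow> 'a topology \<Rightarrow> 'a chart set \<Rightarrow> 'a diff_space" where
  "manifold_diff d T \<A> =
     \<lparr>carrier = topspace T,
      plots = (\<lambda>m U. {p \<in> U \<rightarrow>\<^sub>E topspace T.
        continuous_map (subtopology (Euclidean_space m) U) T p \<and>
        (\<forall>(k, V, \<phi>)\<in>\<A>. smooth_map m {u\<in>U. p u \<in> V} d (\<lambda>u. \<phi> (p u)))})\<rparr>"


section \<open>Sanity checks\<close>

lemma openin_D_topology:
  "openin (D_topology X) A \<longleftrightarrow> A \<subseteq> carrier X \<and>
     (\<forall>n U. \<forall>p\<in>plots X n U.
        openin (Euclidean_space n) U \<longrightarrow> openin (Euclidean_space n) {u\<in>U. p u \<in> A})"
proof -
  let ?P = "\<lambda>A. A \<subseteq> carrier X \<and> (\<forall>n U. \<forall>p\<in>plots X n U.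
        openin (Euclidean_space n) U \<longrightarrow> openin (Euclidean_space n) {u\<in>U. p u \<in> A})"
  have "istopology ?P"
    unfolding istopology_def
  proof (intro conjI allI impI)
    fix S T assume S: "?P S" and T: "?P T"
    show "S \<inter> T \<subseteq> carrier X" using S by blast
    show "\<forall>p\<in>plots X n U. openin (Euclidean_space n) U \<longrightarrow>
            openin (Euclidean_space n) {u\<in>U. p u \<in> S \<inter> T}" for n U
    proof (intro ballI impI)
      fix p assume "p \<in> plots X n U" "openin (Euclidean_space n) U"
      then have "openin (Euclidean_space n) ({u\<in>U. p u \<in> S} \<inter> {u\<in>U. p u \<in> T})"
        using S T by blast
      then show "openin (Euclidean_space n) {u\<in>U. p u \<in> S \<inter> T}"
        by (simp add: Collect_conj_eq [symmetric] Int_def conj_ac cong: conj_cong)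
    qed
  next
    fix \<K> assume K: "\<forall>S\<in>\<K>. ?P S"
    show "\<Union>\<K> \<subseteq> carrier X" using K by blast
    show "\<forall>p\<in>plots X n U. openin (Euclidean_space n) U \<longrightarrow>
            openin (Euclidean_space n) {u\<in>U. p u \<in> \<Union>\<K>}" for n U
    proof (intro ballI impI)
      fix p assume "p \<in> plots X n U" "openin (Euclidean_space n) U"
      then have "openin (Euclidean_space n) (\<Union>((\<lambda>S. {u\<in>U. p u \<in> S}) ` \<K>))"
        using K by (intro openin_Union) blast
      moreover have "\<Union>((\<lambda>S. {u\<in>U. p u \<in> S}) ` \<K>) = {u\<in>U. p u \<in> \<Union>\<K>}" by blast
      ultimately show "openin (Euclidean_space n) {u\<in>U. p u \<in> \<Union>\<K>}" by simp
    qed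
  qed
  then show ?thesis
    by (simp add: D_topology_def topology_inverse')
qed

lemma simplicial_ops_compose:
  assumes "\<eta> \<in> simplicial_ops l m" "\<theta> \<in> simplicial_ops m n"
  shows "compose {..l} \<theta> \<eta> \<in> simplicial_ops l n"
  using assms
  by (fastforce simp: simplicial_ops_def compose_def monotone_on_def PiE_iff)

lemma simplicial_set_standard_simplex: "simplicial_set (standard_simplex_sset n)"
proof -
  have "compose {..m} \<theta> (\<lambda>i\<in>{..m}. i) = \<theta>" if "\<theta> \<in> simplicial_ops m n" for m \<theta>
    using that by (auto simp: simplicial_ops_def compose_def PiE_iff extensional_def)
  moreover have "compose {..l'} (compose {..l} \<theta> \<eta>) \<zeta> = compose {..l'} \<theta> (compose {..l'} \<eta> \<zeta>)"
    if "\<zeta> \<in> simplicial_ops l' l" for l' l \<theta> \<eta> \<zeta>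
    using that by (fastforce simp: simplicial_ops_def compose_def PiE_iff)
  ultimately show ?thesis
    by (auto simp: simplicial_set_def standard_simplex_sset_def simplicial_ops_compose)
qed

lemma simplicial_set_horn: "simplicial_set (horn n k)"
proof -
  have img: "compose {..l} \<theta> \<eta> ` {..l} \<subseteq> \<theta> ` {..m}"
    if "\<eta> \<in> simplicial_ops l m" for l m and \<theta> \<eta> :: "nat \<Rightarrow> nat"
    using that by (auto simp: simplicial_ops_def compose_def PiE_iff)
  have "act (horn n k) l m \<eta> \<theta> \<in> simplices (horn n k) l"
    if "\<eta> \<in> simplicial_ops l m" "\<theta> \<in> simplices (horn n k) m" for l m \<theta> \<eta>
  proof -
    obtain i where "\<theta> \<in> simplicial_ops m n" "i \<le> n" "i \<noteq> k" "i \<notin> \<theta> ` {..m}"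
      using \<open>\<theta> \<in> simplices (horn n k) m\<close> by (auto simp: horn_def)
    moreover from this have "i \<notin> compose {..l} \<theta> \<eta> ` {..l}"
      using img[OF that(1), of \<theta>] by blast
    ultimately have "compose {..l} \<theta> \<eta> \<in> simplicial_ops l n \<and>
        (\<exists>i\<le>n. i \<noteq> k \<and> i \<notin> compose {..l} \<theta> \<eta> ` {..l})"
      using simplicial_ops_compose[OF that(1)] by blast
    then show ?thesis by (simp only: horn_def sset.simps mem_Collect_eq)
  qed
  with simplicial_set_standard_simplex[of n] show ?thesis
    unfolding simplicial_set_def by (simp add: horn_def standard_simplex_sset_def)
qed

lemma eventually_line_in_open:
  assumes "openin (Euclidean_space n) U" "x \<in> U" "i < n"
  shows "\<forall>\<^sub>F t in nhds (x i). x(i := t) \<in> U"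
proof -
  have x: "\<And>j. j \<ge> n \<Longrightarrow> x j = 0"
    using assms openin_subset topspace_Euclidean_space by fastforce
  have "continuous_map euclideanreal (Euclidean_space n) (\<lambda>t. x(i := t))"
    unfolding Euclidean_space_def continuous_map_in_subtopology continuous_map_componentwise_UNIV
    using x \<open>i < n\<close> by (auto simp: fun_upd_def)
  then have "openin euclideanreal {t \<in> topspace euclideanreal. x(i := t) \<in> U}"
    using assms(1) openin_continuous_map_preimage by blast
  then have "open {t. x(i := t) \<in> U}" by simp
  then show ?thesis
    using assms(2) by (auto simp: eventually_nhds intro!: exI[of _ "{t. x(i := t) \<in> U}"])
qed

lemma Ck_on_cong_imp:
  assumes "openin (Euclidean_space n) U" "\<And>x. x \<in> U \<Longrightarrow> f x = g x" "Ck_on k n U f"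
  shows "Ck_on k n U g"
  using assms(2,3)
proof (induction k arbitrary: f g)
  case 0
  then show ?case
    using continuous_map_eq[of "subtopology (Euclidean_space n) U" euclideanreal f g] by auto
next
  case (Suc k)
  have ev: "\<forall>\<^sub>F t in nhds (x i). f (x(i := t)) = g (x(i := t))" if "x \<in> U" "i < n" for x i
    using eventually_line_in_open[OF assms(1) that]
    by (rule eventually_mono) (use Suc.prems(1) in auto)
  have "partial_deriv i f x = partial_deriv i g x" if "x \<in> U" "i < n" for x i
    unfolding partial_deriv_def using ev[OF that] by (intro deriv_cong_ev) auto
  then have "Ck_on k n U (partial_deriv i g)" if "i < n" for i
    using Suc.IH[of "partial_deriv i f" "partial_deriv i g"] Suc.prems(2) that by auto
  moreover have "(\<lambda>t. g (x(i := t))) differentiable (at (x i))" if "x \<in> U" "i < n" for x i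
  proof -
    have "(\<lambda>t. f (x(i := t))) differentiable (at (x i))"
      using Suc.prems(2) that by auto
    then obtain D where "((\<lambda>t. f (x(i := t))) has_field_derivative D) (at (x i))"
      unfolding real_differentiable_def by blast
    then have "((\<lambda>t. g (x(i := t))) has_field_derivative D) (at (x i))"
      using DERIV_cong_ev[OF refl ev[OF that] refl] by blast
    then show ?thesis by (auto simp: real_differentiable_def)
  qed
  moreover have "continuous_map (subtopology (Euclidean_space n) U) euclideanreal g"
    using continuous_map_eq[of "subtopology (Euclidean_space n) U" euclideanreal f g] Suc.prems
    by auto
  ultimately show ?case by simp
qed

lemma Ck_on_zero: "Ck_on k n U (\<lambda>x. 0)"
  by (induction k) (auto simp: partial_deriv_def[abs_def])

lemma Ck_on_add:
  assumes "openin (Euclidean_space n) U" "Ck_on k n U f" "Ck_on k n U g"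
  shows "Ck_on k n U (\<lambda>x. f x + g x)"
  using assms(2,3)
proof (induction k arbitrary: f g)
  case 0
  then show ?case by (auto intro: continuous_map_add)
next
  case (Suc k)
  have "Ck_on k n U (partial_deriv i (\<lambda>x. f x + g x))" if "i < n" for i
  proof (rule Ck_on_cong_imp[OF assms(1)])
    show "Ck_on k n U (\<lambda>x. partial_deriv i f x + partial_deriv i g x)"
      using Suc that by auto
    show "partial_deriv i f x + partial_deriv i g x = partial_deriv i (\<lambda>x. f x + g x) x"
      if "x \<in> U" for x
    proof -
      have "(\<lambda>t. f (x(i := t))) differentiable (at (x i))"
           "(\<lambda>t. g (x(i := t))) differentiable (at (x i))"
        using Suc.prems that \<open>i < n\<close> by auto
      then show ?thesis
        unfolding partial_deriv_def
        by (intro DERIV_imp_deriv[symmetric] DERIV_add) (auto simp: DERIV_deriv_iff_real_differentiable)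
    qed
  qed
  moreover have "(\<lambda>t. f (x(i := t)) + g (x(i := t))) differentiable (at (x i))"
    if "x \<in> U" "i < n" for x i
    using Suc.prems that by (intro differentiable_add) auto
  ultimately show ?case using Suc.prems by (auto intro: continuous_map_add)
qed

lemma Ck_on_sum:
  assumes "openin (Euclidean_space n) U" "finite I" "\<And>i. i \<in> I \<Longrightarrow> Ck_on k n U (f i)"
  shows "Ck_on k n U (\<lambda>x. \<Sum>i\<in>I. f i x)"
  using assms(2,3) by (induction I rule: finite_induct) (auto simp: Ck_on_zero Ck_on_add[OF assms(1)])

lemma affine_push_carrier:
  assumes "\<theta> \<in> simplicial_ops m n" "x \<in> carrier (affine_simplex m)"
  shows "affine_push m \<theta> x \<in> carrier (affine_simplex n)"
proof -
  have \<theta>: "\<theta> ` {..m} \<subseteq> {..n}"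
    using assms(1) by (auto simp: simplicial_ops_def PiE_iff)
  have "(\<Sum>j\<le>n. affine_push m \<theta> x j) = (\<Sum>i\<le>m. x i)"
    unfolding affine_push_def by (rule sum.group) (use \<theta> in auto)
  moreover have "affine_push m \<theta> x j = 0" if "j \<ge> n + 1" for j
  proof -
    have "{i\<in>{..m}. \<theta> i = j} = {}" using \<theta> that by force
    then show ?thesis unfolding affine_push_def by (simp only: sum.empty)
  qed
  ultimately show ?thesis
    using assms(2) by (auto simp: affine_simplex_def sub_diffeology_def topspace_Euclidean_space)
qed

lemma affine_push_smooth:
  assumes "\<theta> \<in> simplicial_ops m n"
  shows "(\<lambda>x\<in>carrier (affine_simplex m). affine_push m \<theta> x)
           \<in> smooth_maps (affine_simplex m) (affine_simplex n)"
proof -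
  let ?push = "\<lambda>x\<in>carrier (affine_simplex m). affine_push m \<theta> x"
  have "compose U ?push p \<in> plots (affine_simplex n) r U"
    if U: "openin (Euclidean_space r) U" and p: "p \<in> plots (affine_simplex m) r U" for r U p
  proof -
    have p': "p u \<in> carrier (affine_simplex m)" if "u \<in> U" for u
      using p that by (auto simp: affine_simplex_def sub_diffeology_def PiE_iff)
    have push: "compose U ?push p \<in> U \<rightarrow>\<^sub>E carrier (affine_simplex n)"
      using p' affine_push_carrier[OF assms] by (auto simp: compose_def PiE_iff)
    have sub: "carrier (affine_simplex n) \<subseteq> topspace (Euclidean_space (n + 1))"
      by (auto simp: affine_simplex_def sub_diffeology_def)
    have ck: "Ck_on k r U (\<lambda>u. p u i)" if "i < m + 1" for i k
      using p that
      by (auto simp: affine_simplex_def sub_diffeology_def euclidean_diff_def smooth_map_def)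
    have "Ck_on k r U (\<lambda>u. compose U ?push p u j)" for j k
    proof (rule Ck_on_cong_imp[OF U])
      show "Ck_on k r U (\<lambda>u. \<Sum>i\<in>{i\<in>{..m}. \<theta> i = j}. p u i)"
        by (rule Ck_on_sum[OF U]) (auto intro: ck)
    qed (use p' in \<open>auto simp: compose_def affine_push_def\<close>)
    then have "smooth_map r U (n + 1) (compose U ?push p)"
      using push sub by (auto simp: smooth_map_def PiE_iff)
    then show ?thesis
      using push sub
      by (auto simp: affine_simplex_def sub_diffeology_def euclidean_diff_def PiE_iff)
  qed
  then show ?thesis
    using affine_push_carrier[OF assms] by (auto simp: smooth_maps_def)
qed

lemma affine_push_id:
  assumes "x \<in> carrier (affine_simplex n)"
  shows "affine_push n (\<lambda>i\<in>{..n}. i) x = x"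
proof
  fix j
  have "{i\<in>{..n}. (\<lambda>i\<in>{..n}. i) i = j} = (if j \<le> n then {j} else {})" by auto
  then show "affine_push n (\<lambda>i\<in>{..n}. i) x j = x j"
    using assms
    by (auto simp: affine_push_def affine_simplex_def sub_diffeology_def topspace_Euclidean_space)
qed

lemma affine_push_compose:
  assumes "\<eta> \<in> simplicial_ops l m"
  shows "affine_push m \<theta> (affine_push l \<eta> x) = affine_push l (compose {..l} \<theta> \<eta>) x"
proof
  fix j
  have \<eta>: "\<eta> ` {..l} \<subseteq> {..m}"
    using assms by (auto simp: simplicial_ops_def PiE_iff)
  let ?I = "{i\<in>{..l}. compose {..l} \<theta> \<eta> i = j}" and ?J = "{a\<in>{..m}. \<theta> a = j}"
  have "(\<Sum>i\<in>?I. x i) = (\<Sum>a\<in>?J. \<Sum>i\<in>{i\<in>?I. \<eta> i = a}. x i)"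
    by (rule sum.group[symmetric]) (use \<eta> in \<open>auto simp: compose_def\<close>)
  also have "\<dots> = (\<Sum>a\<in>?J. \<Sum>i\<in>{i\<in>{..l}. \<eta> i = a}. x i)"
    by (intro sum.cong) (auto simp: compose_def)
  finally show "affine_push m \<theta> (affine_push l \<eta> x) j = affine_push l (compose {..l} \<theta> \<eta>) x j"
    by (simp add: affine_push_def)
qed

lemma smooth_maps_compose:
  assumes "f \<in> smooth_maps X Y" "g \<in> smooth_maps Y Z"
    and "\<And>n U. openin (Euclidean_space n) U \<Longrightarrow> plots X n U \<subseteq> U \<rightarrow>\<^sub>E carrier X"
  shows "compose (carrier X) g f \<in> smooth_maps X Z"
proof -
  have "compose U (compose (carrier X) g f) p \<in> plots Z n U"
    if "openin (Euclidean_space n) U" "p \<in> plots X n U" for n U p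
  proof -
    have "compose U (compose (carrier X) g f) p = compose U g (compose U f p)"
      using assms(3) that by (fastforce simp: compose_def PiE_iff)
    then show ?thesis using assms(1,2) that by (auto simp: smooth_maps_def)
  qed
  then show ?thesis
    using assms(1,2) by (auto simp: smooth_maps_def compose_def PiE_iff)
qed

lemma simplicial_set_smooth_singular: "simplicial_set (smooth_singular X)"
proof -
  have "compose (carrier (affine_simplex m)) \<sigma> (affine_push m \<theta>) \<in> smooth_maps (affine_simplex m) X"
    if "\<theta> \<in> simplicial_ops m n" "\<sigma> \<in> smooth_maps (affine_simplex n) X" for m n \<theta> \<sigma>
  proof -
    have "compose (carrier (affine_simplex m)) \<sigma> (\<lambda>x\<in>carrier (affine_simplex m). affine_push m \<theta> x)
            \<in> smooth_maps (affine_simplex m) X"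
      by (rule smooth_maps_compose[OF affine_push_smooth[OF that(1)] that(2)])
         (auto simp: affine_simplex_def sub_diffeology_def)
    then show ?thesis by (simp add: compose_def cong: restrict_cong)
  qed
  moreover have "compose (carrier (affine_simplex n)) \<sigma> (affine_push n (\<lambda>i\<in>{..n}. i)) = \<sigma>"
    if "\<sigma> \<in> smooth_maps (affine_simplex n) X" for n \<sigma>
    using that affine_push_id
    by (auto simp: smooth_maps_def compose_def PiE_iff extensional_def)
  moreover have "compose (carrier (affine_simplex l))
        (compose (carrier (affine_simplex m)) \<sigma> (affine_push m \<theta>)) (affine_push l \<eta>) =
      compose (carrier (affine_simplex l)) \<sigma> (affine_push l (compose {..l} \<theta> \<eta>))"
    if "\<eta> \<in> simplicial_ops l m" for l m \<eta> \<theta> \<sigma>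
    using affine_push_carrier[OF that] affine_push_compose[OF that]
    by (auto simp: compose_def)
  ultimately show ?thesis
    by (auto simp: simplicial_set_def smooth_singular_def)
qed

end

theory Submission
  imports Defs
begin

text \<open>
  The obstruction is a horn \<open>\<Lambda>\<^sup>3\<^sub>0\<close> in a half-line. Put \<open>Q(a, b, c) = a\<^sup>2 + b\<^sup>2 + c\<^sup>2 - 2 (a b + b c + c a)\<close>.
  On each of the three coordinate planes \<open>Q\<close> is the square of a difference, hence nonnegative, so it
  restricts to a horn in \<open>[0, \<infinity>)\<close>. A filler would be a smooth \<open>H \<ge> 0\<close> near the origin of \<open>\<real>\<^sup>3\<close> agreeing
  with \<open>Q\<close> on the coordinate planes. But up to \<open>O(s\<^sup>3)\<close> the value \<open>H(s, s, s)\<close> is determined by the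
  coordinate planes: the alternating sum of \<open>H\<close> over the vertices of the cube \<open>[0, s]\<^sup>3\<close> is \<open>s\<^sup>3\<close> times a
  mixed third derivative (\<open>third_difference_bound\<close>). As \<open>Q(s, s, 0) = 0\<close> and \<open>Q(s, 0, 0) = s\<^sup>2\<close>, this gives
  \<open>H(s, s, s) = -3 s\<^sup>2 + O(s\<^sup>3) < 0\<close>.

  The faces of the horn are entire planes, whereas a chart of a manifold only contains a short
  segment \<open>[0, \<epsilon>)\<close> transverse to the boundary. So the coordinates are first replaced by their sines and
  the result is scaled into \<open>[0, 1)\<close>; on the faces it is then fed into an arc \<open>c : [0, 1) \<rightarrow> X\<close> that
  starts on the boundary, and a filler is read off near the origin through a coordinate function \<open>h\<close>
  with \<open>h \<ge> 0\<close> and \<open>h \<circ> c = id\<close>, defined on a subset of \<open>X\<close> whose preimage under every plot is open.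
  The lemma \<open>not_fibrant_if_half_open_arc\<close> isolates what is used of \<open>c\<close> and \<open>h\<close>. Half-spaces provide them
  through their zeroth coordinate axis. On a manifold with corners they come from a single chart
  \<open>\<phi>\<close> with \<open>\<phi>\<^sub>i(x) = 0\<close>, by varying the \<open>i\<close>-th coordinate only; the other coordinates of \<open>x\<close> may be zero as
  well, so boundary and corner points need no distinction, nor is invariance of the boundary used.
\<close>

section \<open>Calculus of continuously differentiable functions\<close>

lemma Ck_on_imp_continuous:
  "Ck_on k n U f \<Longrightarrow> continuous_map (subtopology (Euclidean_space n) U) euclideanreal f"
  by (cases k) auto

lemma Ck_on_SucI:
  assumes U: "openin (Euclidean_space n) U"
    and cont: "continuous_map (subtopology (Euclidean_space n) U) euclideanreal f"
    and der: "\<And>i x. \<lbrakk>i < n; x \<in> U\<rbrakk> \<Longrightarrow> ((\<lambda>t. f (x(i := t))) has_real_derivative f' i x) (at (x i))"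
    and Ck: "\<And>i. i < n \<Longrightarrow> Ck_on k n U (f' i)"
  shows "Ck_on (Suc k) n U f"
proof -
  have "Ck_on k n U (partial_deriv i f)" if "i < n" for i
  proof (rule Ck_on_cong_imp[OF U _ Ck[OF that]])
    show "f' i x = partial_deriv i f x" if "x \<in> U" for x
      using DERIV_imp_deriv[OF der[OF \<open>i < n\<close> that]] by (simp add: partial_deriv_def)
  qed
  then show ?thesis
    using cont der by (auto simp: real_differentiable_def)
qed

lemma Ck_on_SucD:
  assumes "Ck_on (Suc k) n U f" "i < n"
  shows "x \<in> U \<Longrightarrow>
      ((\<lambda>t. f (x(i := t))) has_real_derivative partial_deriv i f x) (at (x i))"
    and "Ck_on k n U (partial_deriv i f)"
  using assms by (auto simp: partial_deriv_def DERIV_deriv_iff_real_differentiable)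

lemma Ck_on_SucD_le: "Ck_on (Suc k) n U f \<Longrightarrow> Ck_on k n U f"
  by (induction k arbitrary: f) auto

lemma Ck_on_subset:
  assumes "Ck_on k n U f" "V \<subseteq> U"
  shows "Ck_on k n V f"
  using assms
proof (induction k arbitrary: f)
  case 0
  then show ?case by (auto intro: continuous_map_from_subtopology_mono)
next
  case (Suc k)
  then show ?case by (auto intro: continuous_map_from_subtopology_mono)
qed

lemma Ck_on_local:
  assumes U: "openin (Euclidean_space n) U"
    and loc: "\<And>x. x \<in> U \<Longrightarrow> \<exists>N. openin (Euclidean_space n) N \<and> x \<in> N \<and> Ck_on k n N f"
  shows "Ck_on k n U f"
proof -
  have cont: "continuous_map (subtopology (Euclidean_space n) U) euclideanreal f"
    if loc: "\<And>x. x \<in> U \<Longrightarrow> \<exists>N. openin (Euclidean_space n) N \<and> x \<in> N \<and> Ck_on k n N f" for k f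
    unfolding continuous_map_def
  proof (intro conjI allI impI)
    fix B :: "real set" assume B: "openin euclideanreal B"
    have UE: "topspace (subtopology (Euclidean_space n) U) = U"
      using openin_subset[OF U] by auto
    show "openin (subtopology (Euclidean_space n) U)
            {x \<in> topspace (subtopology (Euclidean_space n) U). f x \<in> B}"
      unfolding UE openin_subopen[of _ "{x \<in> U. f x \<in> B}"]
    proof
      fix x assume "x \<in> {x \<in> U. f x \<in> B}"
      then obtain N where N: "openin (Euclidean_space n) N" "x \<in> N" "Ck_on k n N f"
        and x: "x \<in> U" "f x \<in> B" using loc by blast
      have NE: "topspace (subtopology (Euclidean_space n) N) = N"
        using openin_subset[OF N(1)] by auto
      have "openin (subtopology (Euclidean_space n) N) {x \<in> N. f x \<in> B}"
        using openin_continuous_map_preimage[OF Ck_on_imp_continuous[OF N(3)] B] unfolding NE .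
      then have "openin (Euclidean_space n) {x \<in> N. f x \<in> B}"
        using openin_open_subtopology[OF N(1)] by simp
      then have "openin (subtopology (Euclidean_space n) U) (U \<inter> {x \<in> N. f x \<in> B})"
        by (simp add: openin_subtopology_Int2)
      then show "\<exists>V. openin (subtopology (Euclidean_space n) U) V \<and> x \<in> V \<and>
          V \<subseteq> {x \<in> U. f x \<in> B}"
        using x N by (intro exI[of _ "U \<inter> {x \<in> N. f x \<in> B}"]) auto
    qed
  qed auto
  show ?thesis using loc
  proof (induction k arbitrary: f)
    case 0
    then show ?case using cont[where k=0 and f=f] by simp
  next
    case (Suc k)
    have "Ck_on k n U (partial_deriv i f)" if "i < n" for i
      by (rule Suc.IH) (meson Suc.prems that Ck_on_SucD(2))
    moreover have "(\<lambda>t. f (x(i := t))) differentiable (at (x i))" if "x \<in> U" "i < n" for x i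
      using Suc.prems[OF that(1)] that by auto
    ultimately show ?case using cont[where k="Suc k" and f=f] Suc.prems by simp
  qed
qed

lemma Ck_on_const: "Ck_on k n U (\<lambda>x. a)"
  by (cases k) (auto simp: partial_deriv_def[abs_def] Ck_on_zero)

lemma continuous_map_Euclidean_coord:
  "continuous_map (subtopology (Euclidean_space n) U) euclideanreal (\<lambda>x. x i)"
  unfolding Euclidean_space_def
  by (intro continuous_map_from_subtopology continuous_map_product_projection) auto

lemma Ck_on_coord:
  assumes U: "openin (Euclidean_space n) U"
  shows "Ck_on k n U (\<lambda>x. x i)"
proof (cases k)
  case (Suc k')
  show ?thesis
    unfolding Suc
  proof (rule Ck_on_SucI[OF U continuous_map_Euclidean_coord])
    show "((\<lambda>t. (x(j := t)) i) has_real_derivative (if i = j then 1 else 0)) (at (x j))"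
      for j and x :: "nat \<Rightarrow> real"
      by auto
  qed (rule Ck_on_const)
qed (simp add: continuous_map_Euclidean_coord)

lemma Ck_on_mult:
  assumes U: "openin (Euclidean_space n) U" and "Ck_on k n U f" "Ck_on k n U g"
  shows "Ck_on k n U (\<lambda>x. f x * g x)"
  using assms(2,3)
proof (induction k arbitrary: f g)
  case 0
  then show ?case by (auto intro: continuous_map_real_mult)
next
  case (Suc k)
  show ?case
  proof (rule Ck_on_SucI[OF U])
    show "continuous_map (subtopology (Euclidean_space n) U) euclideanreal (\<lambda>x. f x * g x)"
      using Suc.prems by (auto intro: continuous_map_real_mult)
    show "((\<lambda>t. f (x(i := t)) * g (x(i := t))) has_real_derivative
        partial_deriv i f x * g x + partial_deriv i g x * f x) (at (x i))"
      if "i < n" "x \<in> U" for i x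
      by (rule DERIV_cong[OF DERIV_mult[OF Ck_on_SucD(1)[OF Suc.prems(1) that]
            Ck_on_SucD(1)[OF Suc.prems(2) that]]]) simp
    show "Ck_on k n U (\<lambda>x. partial_deriv i f x * g x + partial_deriv i g x * f x)"
      if "i < n" for i
      using that Suc.prems
      by (intro Ck_on_add[OF U] Suc.IH) (auto intro: Ck_on_SucD(2) Ck_on_SucD_le)
  qed
qed

lemma Ck_on_diff:
  assumes "openin (Euclidean_space n) U" "Ck_on k n U f" "Ck_on k n U g"
  shows "Ck_on k n U (\<lambda>x. f x - g x)"
  using Ck_on_add[OF assms(1,2) Ck_on_mult[OF assms(1) Ck_on_const[of k n U "-1"] assms(3)]]
  by simp

text \<open>The chain rule for an outer function of one variable, given with all its derivatives as the
  sequence \<open>D\<close>.\<close>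

lemma Ck_on_compose_real:
  assumes U: "openin (Euclidean_space n) U" and q: "Ck_on k n U q" "q ` U \<subseteq> S"
    and D: "\<And>m t. t \<in> S \<Longrightarrow> (D m has_real_derivative D (Suc m) t) (at t)"
  shows "Ck_on k n U (\<lambda>x. D m (q x))"
  using q(1)
proof (induction k arbitrary: m)
  have cont: "continuous_map (subtopology (Euclidean_space n) U) euclideanreal (\<lambda>x. D m (q x))"
    if "continuous_map (subtopology (Euclidean_space n) U) euclideanreal q" for m
  proof -
    have "continuous_on S (D m)"
      using D by (intro DERIV_continuous_on) (auto intro: has_field_derivative_at_within)
    then have D: "continuous_map (top_of_set S) euclideanreal (D m)" by simp
    have "continuous_map (subtopology (Euclidean_space n) U) (top_of_set S) q"
      using that q(2) by (auto simp: continuous_map_in_subtopology)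
    from continuous_map_compose[OF this D] show ?thesis
      by (simp add: o_def)
  qed
  {
    case 0
    then show ?case using cont by simp
  next
    case (Suc k)
    show ?case
    proof (rule Ck_on_SucI[OF U cont])
      show "continuous_map (subtopology (Euclidean_space n) U) euclideanreal q"
        using Suc.prems by simp
      show "((\<lambda>t. D m (q (x(i := t)))) has_real_derivative
          D (Suc m) (q x) * partial_deriv i q x) (at (x i))" if "i < n" "x \<in> U" for i x
      proof (rule DERIV_chain2[OF _ Ck_on_SucD(1)[OF Suc.prems that]])
        show "(D m has_real_derivative D (Suc m) (q x)) (at (q (x(i := x i))))"
          using D q(2) that by (simp add: image_subset_iff)
      qed
      show "Ck_on k n U (\<lambda>x. D (Suc m) (q x) * partial_deriv i q x)" if "i < n" for i
        using that Suc.prems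
        by (intro Ck_on_mult[OF U] Suc.IH) (auto intro: Ck_on_SucD(2) Ck_on_SucD_le)
    qed
  }
qed

lemma Ck_on_sin:
  assumes "openin (Euclidean_space n) U" "Ck_on k n U q"
  shows "Ck_on k n U (\<lambda>x. sin (q x))"
proof -
  have "((\<lambda>t. sin (t + real m * (pi/2))) has_real_derivative sin (t + real (Suc m) * (pi/2))) (at t)"
    for m t
  proof -
    have "sin (t + real (Suc m) * (pi/2)) = sin (t + real m * (pi/2) + pi/2)"
      by (simp add: algebra_simps add_divide_distrib)
    also have "\<dots> = cos (t + real m * (pi/2))"
      by (simp add: sin_add)
    finally show ?thesis by (auto intro!: derivative_eq_intros)
  qed
  from Ck_on_compose_real[where D="\<lambda>m t. sin (t + real m * (pi/2))" and S=UNIV and m=0,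
      OF assms subset_UNIV this]
  show ?thesis by simp
qed

lemma continuous_map_fun_upd_Euclidean:
  assumes "x \<in> topspace (Euclidean_space n)" "i < n"
  shows "continuous_map euclideanreal (Euclidean_space n) (\<lambda>t. x(i := t))"
  using assms
  unfolding Euclidean_space_def continuous_map_in_subtopology continuous_map_componentwise_UNIV
  by (auto simp: fun_upd_def)

text \<open>A smooth function of several variables is composed with a function that moves the
  \<open>i\<close>-th coordinate only.\<close>

lemma Ck_on_compose_fun_upd:
  assumes U: "openin (Euclidean_space n) U" and W: "openin (Euclidean_space d) W"
    and G: "\<And>k. Ck_on k d W G" and q: "Ck_on k n U q" and i: "i < d"
    and qW: "\<And>u. u \<in> U \<Longrightarrow> x(i := q u) \<in> W"
  shows "Ck_on k n U (\<lambda>u. G (x(i := q u)))"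
proof -
  have all: "Ck_on k d W ((partial_deriv i ^^ m) G)" for m k
    by (induction m arbitrary: k) (use G i in \<open>auto intro: Ck_on_SucD(2)\<close>)
  have "((\<lambda>t. (partial_deriv i ^^ m) G (x(i := t))) has_real_derivative
      (partial_deriv i ^^ Suc m) G (x(i := t))) (at t)" if "t \<in> {t. x(i := t) \<in> W}" for m t
    using Ck_on_SucD(1)[OF all[of "Suc 0" m] i, of "x(i := t)"] that by simp
  from Ck_on_compose_real[where D="\<lambda>m t. (partial_deriv i ^^ m) G (x(i := t))" and m=0
      and S="{t. x(i := t) \<in> W}", OF U q _ this]
  show ?thesis using qW by (simp add: image_subset_iff)
qed

section \<open>Third differences in three variables\<close>

text \<open>The point \<open>(a, b, c)\<close> of \<open>\<real>\<^sup>3\<close>, as a sequence that vanishes from index \<open>3\<close> on.\<close>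

definition vec3 :: "real \<Rightarrow> real \<Rightarrow> real \<Rightarrow> nat \<Rightarrow> real" where
  "vec3 a b c = (\<lambda>j. if j = 0 then a else if j = 1 then b else if j = 2 then c else 0)"

lemma vec3_upd:
  "(vec3 a b c)(0 := t) = vec3 t b c"
  "(vec3 a b c)(Suc 0 := t) = vec3 a t c"
  "(vec3 a b c)(2 := t) = vec3 a b t"
  by (auto simp: vec3_def fun_eq_iff)

lemma vec3_nth: "vec3 a b c 0 = a" "vec3 a b c (Suc 0) = b" "vec3 a b c 2 = c"
  by (auto simp: vec3_def)

lemma continuous_map_vec3:
  "continuous_map euclidean (Euclidean_space 3) (\<lambda>(a, b, c). vec3 a b c)"
proof -
  have "continuous_on UNIV (\<lambda>p. (case p of (a, b, c) \<Rightarrow> vec3 a b c) j)" for j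
    by (cases "j = 0"; cases "j = 1"; cases "j = 2")
      (auto simp: vec3_def case_prod_unfold intro!: continuous_intros)
  moreover have "vec3 a b c j = 0" if "j \<ge> 3" for a b c j
    using that by (simp add: vec3_def)
  ultimately show ?thesis
    unfolding Euclidean_space_def continuous_map_in_subtopology continuous_map_componentwise_UNIV
    by auto
qed

text \<open>The alternating sum of \<open>H\<close> over the vertices of the cube \<open>[0, s]\<^sup>3\<close> is \<open>s\<^sup>3\<close> times a value of
  the mixed third derivative: the mean value theorem is applied once in each coordinate.\<close>

lemma third_difference_bound:
  assumes W: "openin (Euclidean_space 3) W" and 0: "vec3 0 0 0 \<in> W" and H: "Ck_on 3 3 W H"
  obtains M e where "0 < M" "0 < e"
    and "\<And>a b c. \<lbrakk>\<bar>a\<bar> < e; \<bar>b\<bar> < e; \<bar>c\<bar> < e\<rbrakk> \<Longrightarrow> vec3 a b c \<in> W"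
    and "\<And>s. \<lbrakk>0 < s; s < e\<rbrakk> \<Longrightarrow>
      H (vec3 s s s) - H (vec3 s s 0) - H (vec3 s 0 s) + H (vec3 s 0 0)
        - H (vec3 0 s s) + H (vec3 0 s 0) + H (vec3 0 0 s) - H (vec3 0 0 0) \<le> M * s ^ 3"
proof -
  define H1 where "H1 = partial_deriv 0 H"
  define H2 where "H2 = partial_deriv (Suc 0) H1"
  define K where "K = partial_deriv 2 H2"
  have Ck: "Ck_on (Suc 2) 3 W H" "Ck_on (Suc 1) 3 W H1" "Ck_on (Suc 0) 3 W H2" "Ck_on 0 3 W K"
    using H by (simp_all add: H1_def H2_def K_def eval_nat_numeral)
  define M where "M = \<bar>K (vec3 0 0 0)\<bar> + 1"
  define W' where "W' = {u \<in> topspace (subtopology (Euclidean_space 3) W). K u \<in> {-M<..<M}}"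
  have "openin (subtopology (Euclidean_space 3) W) W'"
    unfolding W'_def
    by (intro openin_continuous_map_preimage[OF Ck_on_imp_continuous[OF Ck(4)]]) auto
  then have W'_open: "openin (Euclidean_space 3) W'"
    using W openin_trans_full by blast
  have "open {p. (case p of (a, b, c) \<Rightarrow> vec3 a b c) \<in> W'}"
    using openin_continuous_map_preimage[OF continuous_map_vec3 W'_open] by simp
  moreover have "vec3 0 0 0 \<in> W'"
    using 0 openin_subset[OF W] by (auto simp: W'_def M_def)
  ultimately obtain A B where AB: "open A" "open B" "0 \<in> A" "(0, 0) \<in> B"
      "A \<times> B \<subseteq> {p. (case p of (a, b, c) \<Rightarrow> vec3 a b c) \<in> W'}"
    by (elim open_prod_elim[where x="(0, 0, 0)"]) auto
  obtain B' C where BC: "open B'" "open C" "0 \<in> B'" "0 \<in> C" "B' \<times> C \<subseteq> B"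
    using open_prod_elim[OF AB(2,4)] by (metis mem_Sigma_iff)
  have "open (A \<inter> B' \<inter> C)" "0 \<in> A \<inter> B' \<inter> C"
    using AB BC by auto
  then obtain e where e: "e > 0" "ball 0 e \<subseteq> A \<inter> B' \<inter> C"
    using open_contains_ball by metis
  have box': "vec3 a b c \<in> W'" if "\<bar>a\<bar> < e" "\<bar>b\<bar> < e" "\<bar>c\<bar> < e" for a b c
  proof -
    have "a \<in> A" "b \<in> B'" "c \<in> C"
      using e(2) that by (auto simp: subset_iff)
    then have "(a, b, c) \<in> A \<times> B" using BC(5) by auto
    then show ?thesis using AB(5) by auto
  qed
  have box: "vec3 a b c \<in> W" if "\<bar>a\<bar> < e" "\<bar>b\<bar> < e" "\<bar>c\<bar> < e" for a b c
    using box'[OF that] by (simp add: W'_def)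
  have D0: "((\<lambda>t. H (vec3 t b c)) has_real_derivative H1 (vec3 a b c)) (at a)"
    if "\<bar>a\<bar> < e" "\<bar>b\<bar> < e" "\<bar>c\<bar> < e" for a b c
    using Ck_on_SucD(1)[OF Ck(1) _ box[OF that], of 0] by (simp add: vec3_upd vec3_nth H1_def)
  have D1: "((\<lambda>t. H1 (vec3 a t c)) has_real_derivative H2 (vec3 a b c)) (at b)"
    if "\<bar>a\<bar> < e" "\<bar>b\<bar> < e" "\<bar>c\<bar> < e" for a b c
    using Ck_on_SucD(1)[OF Ck(2) _ box[OF that], of "Suc 0"]
    by (simp add: vec3_upd vec3_nth H2_def)
  have D2: "((\<lambda>t. H2 (vec3 a b t)) has_real_derivative K (vec3 a b c)) (at c)"
    if "\<bar>a\<bar> < e" "\<bar>b\<bar> < e" "\<bar>c\<bar> < e" for a b c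
    using Ck_on_SucD(1)[OF Ck(3) _ box[OF that], of 2] by (simp add: vec3_upd vec3_nth K_def)
  have "H (vec3 s s s) - H (vec3 s s 0) - H (vec3 s 0 s) + H (vec3 s 0 0)
        - H (vec3 0 s s) + H (vec3 0 s 0) + H (vec3 0 0 s) - H (vec3 0 0 0) \<le> M * s ^ 3"
    if s: "0 < s" "s < e" for s
  proof -
    let ?g0 = "\<lambda>t. H (vec3 t s s) - H (vec3 t s 0) - H (vec3 t 0 s) + H (vec3 t 0 0)"
    have "\<exists>x>0. x < s \<and> ?g0 s - ?g0 0 =
        (s - 0) * (H1 (vec3 x s s) - H1 (vec3 x s 0) - H1 (vec3 x 0 s) + H1 (vec3 x 0 0))"
      by (rule MVT2[OF s(1)]) (use s in \<open>auto intro!: derivative_intros D0\<close>)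
    then obtain x where x: "0 < x" "x < s" and g0: "?g0 s - ?g0 0 =
        s * (H1 (vec3 x s s) - H1 (vec3 x s 0) - H1 (vec3 x 0 s) + H1 (vec3 x 0 0))"
      by auto
    let ?g1 = "\<lambda>t. H1 (vec3 x t s) - H1 (vec3 x t 0)"
    have "\<exists>y>0. y < s \<and> ?g1 s - ?g1 0 = (s - 0) * (H2 (vec3 x y s) - H2 (vec3 x y 0))"
      by (rule MVT2[OF s(1)]) (use s x in \<open>auto intro!: derivative_intros D1\<close>)
    then obtain y where y: "0 < y" "y < s"
      and g1: "?g1 s - ?g1 0 = s * (H2 (vec3 x y s) - H2 (vec3 x y 0))" by auto
    have "\<exists>z>0. z < s \<and> H2 (vec3 x y s) - H2 (vec3 x y 0) = (s - 0) * K (vec3 x y z)"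
      by (rule MVT2[OF s(1)]) (use s x y in \<open>auto intro!: D2\<close>)
    then obtain z where z: "0 < z" "z < s"
      and g2: "H2 (vec3 x y s) - H2 (vec3 x y 0) = s * K (vec3 x y z)" by auto
    have "?g0 s - ?g0 0 = s * (?g1 s - ?g1 0)"
      using g0 by (simp add: algebra_simps)
    also have "\<dots> = s * (s * (s * K (vec3 x y z)))"
      by (simp only: g1 g2)
    also have "\<dots> = K (vec3 x y z) * s ^ 3"
      by (simp add: power3_eq_cube)
    also have "\<dots> \<le> M * s ^ 3"
    proof (rule mult_right_mono)
      show "K (vec3 x y z) \<le> M"
        using box'[of x y z] s x y z by (auto simp: W'_def)
    qed (use s in auto)
    finally show ?thesis by (simp add: algebra_simps)
  qed
  then show thesis
    using that[of M e] e(1) box by (auto simp: M_def)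
qed

text \<open>The quadratic form \<open>a\<^sup>2 + b\<^sup>2 + c\<^sup>2 - 2 (a b + b c + c a)\<close> in the sines of its arguments, scaled
  by \<open>1/8\<close>. When one argument is zero and the others are \<open>x\<close> and \<open>y\<close>, the form is \<open>(sin x - sin y)\<^sup>2 \<le> 4\<close>, so
  the scaled value lies below \<open>1\<close>.\<close>

definition face_form :: "real \<Rightarrow> real \<Rightarrow> real \<Rightarrow> real" where
  "face_form a b c = (1/8) * ((sin a * sin a + sin b * sin b + sin c * sin c)
     - 2 * (sin a * sin b + sin b * sin c + sin c * sin a))"

lemma face_form_range:
  assumes "a = 0 \<or> b = 0 \<or> c = 0"
  shows "face_form a b c \<in> {0..<1}"
proof -
  have *: "(1/8) * (sin x * sin x + sin y * sin y - 2 * (sin x * sin y)) \<in> {0..<1}" for x y :: real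
  proof -
    have eq: "(1/8) * (sin x * sin x + sin y * sin y - 2 * (sin x * sin y)) = (sin x - sin y)\<^sup>2 / 8"
      by (simp add: power2_eq_square algebra_simps)
    have "\<bar>sin x - sin y\<bar> \<le> 2"
      using sin_ge_minus_one[of x] sin_ge_minus_one[of y] sin_le_one[of x] sin_le_one[of y]
      by linarith
    then have "(sin x - sin y)\<^sup>2 \<le> 2\<^sup>2"
      by (simp only: power2_le_iff_abs_le)
    then show ?thesis unfolding eq by simp
  qed
  show ?thesis
    using assms *[of a b] *[of b c] *[of c a] by (auto simp: face_form_def add_ac)
qed

lemma Ck_on_face_form:
  assumes "openin (Euclidean_space n) U" "Ck_on k n U f" "Ck_on k n U g" "Ck_on k n U h"
  shows "Ck_on k n U (\<lambda>x. face_form (f x) (g x) (h x))"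
  unfolding face_form_def
  by (intro Ck_on_mult Ck_on_diff Ck_on_add Ck_on_sin Ck_on_const assms)

text \<open>If \<open>H \<ge> 0\<close> agrees with the form on the coordinate planes, then its third difference over a small
  cube \<open>[0, s]\<^sup>3\<close> is at least \<open>3 sin\<^sup>2 s / 8\<close>, which is not bounded by a multiple of \<open>s\<^sup>3\<close>.\<close>

lemma no_nonneg_extension_of_face_form:
  assumes W: "openin (Euclidean_space 3) W" "vec3 0 0 0 \<in> W" and H: "Ck_on 3 3 W H"
    and nonneg: "\<And>u. u \<in> W \<Longrightarrow> 0 \<le> H u"
    and faces: "\<And>a b c. \<lbrakk>vec3 a b c \<in> W; a = 0 \<or> b = 0 \<or> c = 0\<rbrakk> \<Longrightarrow>
                  H (vec3 a b c) = face_form a b c"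
  shows False
proof -
  obtain M e where M: "0 < M" and e: "0 < e"
    and box: "\<And>a b c. \<lbrakk>\<bar>a\<bar> < e; \<bar>b\<bar> < e; \<bar>c\<bar> < e\<rbrakk> \<Longrightarrow> vec3 a b c \<in> W"
    and bound: "\<And>s. \<lbrakk>0 < s; s < e\<rbrakk> \<Longrightarrow>
      H (vec3 s s s) - H (vec3 s s 0) - H (vec3 s 0 s) + H (vec3 s 0 0)
        - H (vec3 0 s s) + H (vec3 0 s 0) + H (vec3 0 0 s) - H (vec3 0 0 0) \<le> M * s ^ 3"
    using third_difference_bound[OF W H] by blast
  \<comment> \<open>For \<open>0 < s \<le> 1\<close> one has \<open>3 sin\<^sup>2 s / 8 > 3 s\<^sup>2 / 32\<close>, and \<open>M s\<^sup>3 \<le> s\<^sup>2 / 16\<close> is smaller.\<close>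
  define s where "s = min (min (e/2) 1) (1 / (16 * M))"
  have s: "0 < s" "s < e" "s \<le> 1" and "s \<le> 1 / (16 * M)"
    using M e by (auto simp: s_def)
  then have Ms: "M * s \<le> 1/16"
    using M by (simp add: field_simps)
  have "\<exists>z>0. z < s \<and> sin s - sin 0 = (s - 0) * cos z"
    by (rule MVT2[OF s(1)]) (auto intro!: derivative_eq_intros)
  then obtain z where z: "0 < z" "z < s" "sin s = s * cos z" by auto
  have "cos (pi/3) < cos z"
    using z s pi_gt3 by (intro cos_monotone_0_pi) auto
  then have "s * (1/2) < sin s"
    using s z by (simp add: cos_60)
  then have "(s * (1/2)) * (s * (1/2)) < sin s * sin s"
    using s by (intro mult_strict_mono) auto
  moreover have "0 \<le> H (vec3 s s s)"
    using s by (intro nonneg box) auto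
  moreover have "(3/8) * (sin s * sin s) + H (vec3 s s s) \<le> M * s ^ 3"
    using bound[OF s(1,2)] s e by (simp add: faces box face_form_def algebra_simps)
  moreover have "M * s ^ 3 \<le> (1/16) * (s * s)"
    using mult_right_mono[OF Ms, of "s * s"] s by (simp add: power3_eq_cube mult.assoc)
  moreover have "0 < s * s" using s by simp
  ultimately show False by (simp add: algebra_simps)
qed

section \<open>A horn without filler\<close>

lemma carrier_affine_simplex:
  "x \<in> carrier (affine_simplex m) \<longleftrightarrow>
     x \<in> topspace (Euclidean_space (m + 1)) \<and> (\<Sum>i\<le>m. x i) = 1"
  by (simp add: affine_simplex_def sub_diffeology_def)

lemma plots_affine_simplex:
  "p \<in> plots (affine_simplex m) r U \<longleftrightarrow>
     p \<in> U \<rightarrow>\<^sub>E carrier (affine_simplex m) \<and> (\<forall>j\<le>m. \<forall>k. Ck_on k r U (\<lambda>u. p u j))"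
  by (auto simp: affine_simplex_def sub_diffeology_def euclidean_diff_def smooth_map_def PiE_iff
      less_Suc_eq_le)

text \<open>The affine parametrization of the affine 3-simplex by \<open>\<real>\<^sup>3\<close> that sends the origin to the
  vertex \<open>0\<close>; the coordinates \<open>u\<^sub>0, u\<^sub>1, u\<^sub>2\<close> become the barycentric coordinates \<open>1, 2, 3\<close>.\<close>

definition barycentric :: "(nat \<Rightarrow> real) \<Rightarrow> nat \<Rightarrow> real" where
  "barycentric u = (\<lambda>j. case j of 0 \<Rightarrow> 1 - (u 0 + u 1 + u 2) | Suc i \<Rightarrow> u i)"

lemma barycentric_plot:
  "(\<lambda>u\<in>topspace (Euclidean_space 3). barycentric u)
     \<in> plots (affine_simplex 3) 3 (topspace (Euclidean_space 3))"
proof -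
  let ?E = "topspace (Euclidean_space 3)"
  have "barycentric u \<in> carrier (affine_simplex 3)" if "u \<in> ?E" for u
    using that by (auto simp: carrier_affine_simplex topspace_Euclidean_space barycentric_def
        eval_nat_numeral split: nat.split)
  moreover have "Ck_on k 3 ?E (\<lambda>u. (\<lambda>u\<in>?E. barycentric u) u j)" for k j
  proof (rule Ck_on_cong_imp)
    show "Ck_on k 3 ?E (\<lambda>u. barycentric u j)"
      unfolding barycentric_def
      by (cases j) (auto intro!: Ck_on_diff Ck_on_add Ck_on_coord Ck_on_const)
  qed auto
  ultimately show ?thesis by (auto simp: plots_affine_simplex)
qed

text \<open>For \<open>1 \<le> i \<le> n\<close>, the endomorphism of \<open>[n]\<close> that sends \<open>i\<close> to \<open>i - 1\<close> and fixes the rest. It misses \<open>i\<close>,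
  so it is a (degenerate) simplex of the horn \<open>\<Lambda>\<^sup>n\<^sub>0\<close>, and the affine map that it induces is the identity
  on the face \<open>x\<^sub>i = 0\<close>. A filler can thus be compared with the horn on that face without lowering the
  dimension.\<close>

definition collapse :: "nat \<Rightarrow> nat \<Rightarrow> nat \<Rightarrow> nat" where
  "collapse n i = (\<lambda>j\<in>{..n}. if j = i then i - 1 else j)"

lemma collapse_horn:
  assumes "1 \<le> i" "i \<le> n"
  shows "collapse n i \<in> simplices (horn n 0) n"
proof -
  have "collapse n i \<in> simplicial_ops n n"
    using assms by (auto simp: simplicial_ops_def collapse_def mono_on_def)
  moreover have "i \<notin> collapse n i ` {..n}"
    using assms by (auto simp: collapse_def)
  ultimately show ?thesis
    using assms unfolding horn_def by auto
qed

lemma affine_push_collapse: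
  assumes "1 \<le> i" "i \<le> n" "y \<in> carrier (affine_simplex n)" "y i = 0"
  shows "affine_push n (collapse n i) y = y"
proof
  fix j
  show "affine_push n (collapse n i) y j = y j"
  proof (cases "j \<le> n")
    case True
    have "affine_push n (collapse n i) y j
        = (\<Sum>a\<in>{a\<in>{..n}. collapse n i a = j}. if a = j then y j else 0)"
      unfolding affine_push_def
      by (rule sum.cong) (use assms in \<open>auto simp: collapse_def split: if_splits\<close>)
    also have "\<dots> = y j"
      using True assms by (auto simp: collapse_def)
    finally show ?thesis .
  next
    case False
    then have "{a\<in>{..n}. collapse n i a = j} = {}"
      using assms by (auto simp: collapse_def)
    then have "affine_push n (collapse n i) y j = 0"
      by (simp only: affine_push_def sum.empty)
    then show ?thesis
      using False assms(3) by (simp add: carrier_affine_simplex topspace_Euclidean_space)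
  qed
qed

text \<open>Here \<open>A\<close> plays the role of a half-space in \<open>X\<close>, \<open>h\<close> that of its nonnegative coordinate, and \<open>c\<close> that
  of an arc along which \<open>h\<close> increases from \<open>0\<close>. Smoothness of \<open>c\<close> is only required along functions that are
  smooth as functions to \<open>\<real>\<close>.\<close>

lemma not_fibrant_if_half_open_arc:
  fixes X :: "'a diff_space" and h :: "'a \<Rightarrow> real" and c :: "real \<Rightarrow> 'a"
  assumes A: "A \<subseteq> carrier X"
    and cA: "\<And>t. \<lbrakk>0 \<le> t; t < 1\<rbrakk> \<Longrightarrow> c t \<in> A" and hc: "\<And>t. \<lbrakk>0 \<le> t; t < 1\<rbrakk> \<Longrightarrow> h (c t) = t"
    and nonneg: "\<And>a. a \<in> A \<Longrightarrow> 0 \<le> h a"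
    and c: "\<And>r U q. \<lbrakk>openin (Euclidean_space r) U; \<And>k. Ck_on k r U q; q ` U \<subseteq> {0..<1}\<rbrakk>
              \<Longrightarrow> (\<lambda>u\<in>U. c (q u)) \<in> plots X r U"
    and openA: "\<And>r U p. \<lbrakk>openin (Euclidean_space r) U; p \<in> plots X r U\<rbrakk>
              \<Longrightarrow> openin (Euclidean_space r) {u\<in>U. p u \<in> A}"
    and h: "\<And>r U p k. \<lbrakk>openin (Euclidean_space r) U; p \<in> plots X r U\<rbrakk>
              \<Longrightarrow> Ck_on k r {u\<in>U. p u \<in> A} (\<lambda>u. h (p u))"
  shows "\<not> fibrant X"
proof
  assume "fibrant X"
  define q where "q y = face_form (y 1) (y 2) (y 3)" for y :: "nat \<Rightarrow> real"
  define \<sigma> where "\<sigma> m \<theta> = (\<lambda>x\<in>carrier (affine_simplex m). c (q (affine_push m \<theta> x)))"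
    for m and \<theta> :: "nat \<Rightarrow> nat"
  have horn: "\<theta> \<in> simplicial_ops m 3 \<and> (\<exists>i\<in>{1, 2, 3}. i \<notin> \<theta> ` {..m})"
    if "\<theta> \<in> simplices (horn 3 0) m" for m \<theta>
  proof -
    have \<theta>: "\<theta> \<in> simplicial_ops m 3" and "\<exists>i\<le>3. i \<noteq> 0 \<and> i \<notin> \<theta> ` {..m}"
      using that unfolding horn_def by simp_all
    then obtain i where i: "i \<le> 3" "i \<noteq> 0" "i \<notin> \<theta> ` {..m}" by blast
    then have "i = 1 \<or> i = 2 \<or> i = 3" by linarith
    with i \<theta> show ?thesis by auto
  qed
  have q_range: "q (affine_push m \<theta> x) \<in> {0..<1}" if \<theta>: "\<theta> \<in> simplices (horn 3 0) m" for m \<theta> x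
  proof -
    obtain i where i: "i \<in> {1, 2, 3}" "i \<notin> \<theta> ` {..m}" using horn[OF \<theta>] by blast
    then have "{a\<in>{..m}. \<theta> a = i} = {}" by auto
    then have "affine_push m \<theta> x i = 0" by (simp only: affine_push_def sum.empty)
    then show ?thesis
      unfolding q_def using i(1) by (intro face_form_range) auto
  qed
  have \<sigma>_smooth: "\<sigma> m \<theta> \<in> smooth_maps (affine_simplex m) X"
    if \<theta>: "\<theta> \<in> simplices (horn 3 0) m" for m \<theta>
  proof -
    have "compose U (\<sigma> m \<theta>) p \<in> plots X r U"
      if U: "openin (Euclidean_space r) U" and p: "p \<in> plots (affine_simplex m) r U" for r U p
    proof -
      have "compose U (\<sigma> m \<theta>) p = (\<lambda>u\<in>U. c (q (affine_push m \<theta> (p u))))"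
        using p by (auto simp: compose_def \<sigma>_def plots_affine_simplex PiE_iff fun_eq_iff)
      also have "\<dots> \<in> plots X r U"
      proof (rule c[OF U])
        have "Ck_on k r U (\<lambda>u. affine_push m \<theta> (p u) j)" for k j
          unfolding affine_push_def
          by (rule Ck_on_sum[OF U]) (use p in \<open>auto simp: plots_affine_simplex\<close>)
        then show "Ck_on k r U (\<lambda>u. q (affine_push m \<theta> (p u)))" for k
          unfolding q_def by (intro Ck_on_face_form U)
        show "(\<lambda>u. q (affine_push m \<theta> (p u))) ` U \<subseteq> {0..<1}"
          using q_range[OF \<theta>] by blast
      qed
      finally show ?thesis .
    qed
    moreover have "\<sigma> m \<theta> \<in> carrier (affine_simplex m) \<rightarrow>\<^sub>E carrier X"
      using q_range[OF \<theta>] cA A by (auto simp: \<sigma>_def)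
    ultimately show ?thesis by (simp add: smooth_maps_def)
  qed
  have "simplicial_map (horn 3 0) (smooth_singular X) \<sigma>"
    unfolding simplicial_map_def
  proof (intro conjI allI ballI)
    show "\<sigma> m \<theta> \<in> simplices (smooth_singular X) m" if "\<theta> \<in> simplices (horn 3 0) m" for m \<theta>
      using \<sigma>_smooth[OF that] by (simp add: smooth_singular_def)
    show "\<sigma> l (act (horn 3 0) l m \<eta> \<theta>) = act (smooth_singular X) l m \<eta> (\<sigma> m \<theta>)"
      if \<eta>: "\<eta> \<in> simplicial_ops l m" and "\<theta> \<in> simplices (horn 3 0) m" for l m \<eta> \<theta>
      using affine_push_carrier[OF \<eta>] affine_push_compose[OF \<eta>, of \<theta>]
      by (auto simp: horn_def smooth_singular_def \<sigma>_def compose_def[of "carrier (affine_simplex l)"]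
          intro!: ext)
  qed
  then obtain \<tau> where \<tau>: "simplicial_map (standard_simplex_sset 3) (smooth_singular X) \<tau>"
    and \<tau>\<sigma>: "\<And>m \<theta>. \<theta> \<in> simplices (horn 3 0) m \<Longrightarrow> \<tau> m \<theta> = \<sigma> m \<theta>"
    using \<open>fibrant X\<close> unfolding fibrant_def kan_complex_def
    by (metis le0 one_le_numeral)
  define id3 where "id3 = (\<lambda>i\<in>{..3::nat}. i)"
  have id3: "id3 \<in> simplicial_ops 3 3"
    by (auto simp: id3_def simplicial_ops_def mono_on_def)
  define F where "F = \<tau> 3 id3"
  have F_smooth: "F \<in> smooth_maps (affine_simplex 3) X"
    using \<tau> id3 unfolding simplicial_map_def F_def
    by (simp add: standard_simplex_sset_def smooth_singular_def)
  \<comment> \<open>On the faces \<open>1, 2, 3\<close> the filler is given by the same formula as the horn.\<close>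
  have F_face: "F y = c (q y)"
    if y: "y \<in> carrier (affine_simplex 3)" "y i = 0" and i: "i \<in> {1, 2, 3}" for y i
  proof -
    have i': "1 \<le> i" "i \<le> 3" using i by auto
    have horn_i: "collapse 3 i \<in> simplices (horn 3 0) 3" by (rule collapse_horn[OF i'])
    then have ops: "collapse 3 i \<in> simplicial_ops 3 3" using horn by blast
    have "compose {..3} id3 (collapse 3 i) = collapse 3 i"
      using ops by (auto simp: id3_def compose_def simplicial_ops_def PiE_iff extensional_def
          fun_eq_iff)
    then have "\<tau> 3 (collapse 3 i)
        = compose (carrier (affine_simplex 3)) F (affine_push 3 (collapse 3 i))"
      using \<tau> id3 ops unfolding simplicial_map_def F_def
      by (simp add: standard_simplex_sset_def smooth_singular_def) metis
    then have "\<sigma> 3 (collapse 3 i) y = F (affine_push 3 (collapse 3 i) y)"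
      using \<tau>\<sigma>[OF horn_i] y(1) by (simp add: compose_def)
    then show ?thesis
      using y(1) affine_push_collapse[OF i' y] by (simp add: \<sigma>_def)
  qed
  define E where "E = topspace (Euclidean_space 3)"
  define P where "P = compose E F (\<lambda>u\<in>E. barycentric u)"
  have openE: "openin (Euclidean_space 3) E" by (simp add: E_def)
  have P_plot: "P \<in> plots X 3 E"
    using F_smooth barycentric_plot openE unfolding smooth_maps_def P_def E_def by blast
  define W where "W = {u\<in>E. P u \<in> A}"
  have vec3_E: "vec3 a b d \<in> E" for a b d
    by (auto simp: E_def topspace_Euclidean_space vec3_def)
  have P_face: "P (vec3 a b d) = c (face_form a b d) \<and> face_form a b d \<in> {0..<1}"
    if "a = 0 \<or> b = 0 \<or> d = 0" for a b d
  proof -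
    let ?y = "barycentric (vec3 a b d)"
    have y: "?y \<in> carrier (affine_simplex 3)"
      using barycentric_plot vec3_E[of a b d] by (auto simp: plots_affine_simplex E_def)
    have nth: "?y 1 = a" "?y 2 = b" "?y 3 = d"
      by (simp_all add: barycentric_def vec3_def eval_nat_numeral)
    have "F ?y = c (q ?y)"
      using that F_face[OF y, of 1] F_face[OF y, of 2] F_face[OF y, of 3] nth by auto
    then show ?thesis
      using nth vec3_E that face_form_range by (simp add: P_def compose_def q_def)
  qed
  have "vec3 0 0 0 \<in> W"
    using P_face[of 0 0 0] vec3_E cA by (auto simp: W_def)
  then show False
  proof (rule no_nonneg_extension_of_face_form[rotated])
    show "openin (Euclidean_space 3) W" unfolding W_def by (rule openA[OF openE P_plot])
    show "Ck_on 3 3 W (\<lambda>u. h (P u))" unfolding W_def by (rule h[OF openE P_plot])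
    show "0 \<le> h (P u)" if "u \<in> W" for u using that nonneg by (simp add: W_def)
    show "h (P (vec3 a b d)) = face_form a b d" if "a = 0 \<or> b = 0 \<or> d = 0" for a b d
      using P_face[OF that] hc by auto
  qed
qed

section \<open>Half-spaces and manifolds with corners\<close>

lemma carrier_half_space:
  "x \<in> carrier (half_space n) \<longleftrightarrow> x \<in> topspace (Euclidean_space (n + 1)) \<and> 0 \<le> x 0"
  by (simp add: half_space_def sub_diffeology_def)

lemma plots_half_space:
  "p \<in> plots (half_space n) r U \<longleftrightarrow>
     p \<in> U \<rightarrow>\<^sub>E carrier (half_space n) \<and> (\<forall>j\<le>n. \<forall>k. Ck_on k r U (\<lambda>u. p u j))"
  by (auto simp: half_space_def sub_diffeology_def euclidean_diff_def smooth_map_def PiE_iff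
      less_Suc_eq_le)

lemma plots_sub_diffeology:
  "p \<in> plots (sub_diffeology X A) r U \<longleftrightarrow> p \<in> U \<rightarrow>\<^sub>E A \<and> p \<in> plots X r U"
  by (simp add: sub_diffeology_def)

lemma plot_restrict:
  assumes X: "diffeological_space X" and p: "p \<in> plots X r U"
    and U: "openin (Euclidean_space r) U" and V: "openin (Euclidean_space r) V" "V \<subseteq> U"
  shows "restrict p V \<in> plots X r V"
proof -
  have "smooth_map r V r (\<lambda>u. u)"
    using Ck_on_coord[OF V(1)] openin_subset[OF V(1)] by (auto simp: smooth_map_def)
  then have "compose V p (\<lambda>u. u) \<in> plots X r V"
    using X p U V unfolding diffeological_space_def by (metis image_ident)
  then show ?thesis by (simp add: compose_def)
qed

lemma not_fibrant_if_contains_half_space: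
  assumes X: "diffeological_space X" and A: "openin (D_topology X) A"
    and diffeo: "diffeomorphic (sub_diffeology X A) (half_space n)"
  shows "\<not> fibrant X"
proof -
  obtain f g where f: "f \<in> smooth_maps (sub_diffeology X A) (half_space n)"
    and g: "g \<in> smooth_maps (half_space n) (sub_diffeology X A)"
    and fg: "compose (carrier (half_space n)) f g = (\<lambda>y\<in>carrier (half_space n). y)"
    using diffeo unfolding diffeomorphic_def by blast
  have carrier_sub: "carrier (sub_diffeology X A) = A" by (simp add: sub_diffeology_def)
  \<comment> \<open>The zeroth coordinate axis, which is transverse to the boundary.\<close>
  define e where "e t = (\<lambda>j::nat. if j = 0 then t else 0)" for t :: real
  have e: "e t \<in> carrier (half_space n)" if "0 \<le> t" for t
    using that by (auto simp: e_def carrier_half_space topspace_Euclidean_space)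
  have g_in: "g (e t) \<in> A" and fg': "f (g (e t)) = e t" if "0 \<le> t" for t
    using g e[OF that] fun_cong[OF fg, of "e t"]
    by (auto simp: smooth_maps_def carrier_sub compose_def PiE_iff)
  have openA: "openin (Euclidean_space r) {u\<in>U. p u \<in> A}"
    if "openin (Euclidean_space r) U" "p \<in> plots X r U" for r U p
    using A that by (simp add: openin_D_topology)
  show ?thesis
  proof (rule not_fibrant_if_half_open_arc)
    show "A \<subseteq> carrier X" using A by (simp add: openin_D_topology)
    show "g (e t) \<in> A" if "0 \<le> t" for t using g_in[OF that] .
    show "f (g (e t)) 0 = t" if "0 \<le> t" for t using fg'[OF that] by (simp add: e_def)
    show "0 \<le> f a 0" if "a \<in> A" for a
    proof -
      have "f a \<in> carrier (half_space n)"
        using f that by (auto simp: smooth_maps_def carrier_sub PiE_iff)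
      then show ?thesis by (simp add: carrier_half_space)
    qed
    show "(\<lambda>u\<in>U. g (e (q u))) \<in> plots X r U"
      if U: "openin (Euclidean_space r) U" and q: "\<And>k. Ck_on k r U q" "q ` U \<subseteq> {0..<1}" for r U q
    proof -
      have "Ck_on k r U (\<lambda>u. (\<lambda>u\<in>U. e (q u)) u j)" for k j
        by (rule Ck_on_cong_imp[OF U, of "\<lambda>u. if j = 0 then q u else 0"])
          (cases "j = 0"; simp add: e_def Ck_on_zero q(1))+
      then have "(\<lambda>u\<in>U. e (q u)) \<in> plots (half_space n) r U"
        using e q(2) by (auto simp: plots_half_space image_subset_iff)
      then have "compose U g (\<lambda>u\<in>U. e (q u)) \<in> plots X r U"
        using g U by (auto simp: smooth_maps_def plots_sub_diffeology)
      then show ?thesis by (simp add: compose_def cong: restrict_cong)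
    qed
    show "openin (Euclidean_space r) {u\<in>U. p u \<in> A}"
      if "openin (Euclidean_space r) U" "p \<in> plots X r U" for r U p
      using openA[OF that] .
    show "Ck_on k r {u\<in>U. p u \<in> A} (\<lambda>u. f (p u) 0)"
      if U: "openin (Euclidean_space r) U" and p: "p \<in> plots X r U" for r U p k
    proof -
      let ?W = "{u\<in>U. p u \<in> A}"
      have W: "openin (Euclidean_space r) ?W" by (rule openA[OF U p])
      have "restrict p ?W \<in> plots (sub_diffeology X A) r ?W"
        using plot_restrict[OF X p U W] by (auto simp: plots_sub_diffeology)
      then have "compose ?W f (restrict p ?W) \<in> plots (half_space n) r ?W"
        using f W by (auto simp: smooth_maps_def)
      then have "Ck_on k r ?W (\<lambda>u. compose ?W f (restrict p ?W) u 0)"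
        by (simp add: plots_half_space)
      then show ?thesis
        by (rule Ck_on_cong_imp[OF W, rotated]) (simp add: compose_def)
    qed
  qed
qed

lemma openin_preimage_on:
  assumes "openin T U" "continuous_map (subtopology T U) S f" "openin S W"
  shows "openin T {u\<in>U. f u \<in> W}"
proof -
  have UE: "topspace (subtopology T U) = U"
    using openin_subset[OF assms(1)] by auto
  have "openin (subtopology T U) {u\<in>U. f u \<in> W}"
    using openin_continuous_map_preimage[OF assms(2,3)] unfolding UE .
  then show ?thesis using openin_open_subtopology[OF assms(1)] by simp
qed

lemma not_fibrant_manifold_with_corners:
  assumes M: "smooth_manifold_with_corners d T \<A>" and bd: "manifold_boundary \<A> \<noteq> {}"
  shows "\<not> fibrant (manifold_diff d T \<A>)"
proof -
  obtain x k V \<phi> i where chart: "(k, V, \<phi>) \<in> \<A>" and x: "x \<in> V" and i: "i < k" "\<phi> x i = 0"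
    using bd unfolding manifold_boundary_def by blast
  have charts: "corner_chart d T c" if "c \<in> \<A>" for c
    using M that unfolding smooth_manifold_with_corners_def by blast
  have chart_facts: "k \<le> d" "openin T V" "V \<subseteq> topspace T"
      "openin (subtopology (Euclidean_space d) (sector d k)) (\<phi> ` V)"
      "homeomorphic_map (subtopology T V) (subtopology (Euclidean_space d) (\<phi> ` V)) \<phi>"
      "\<phi> ` V \<subseteq> sector d k" "\<phi> ` V \<subseteq> topspace (Euclidean_space d)"
    if "(k, V, \<phi>) \<in> \<A>" for k V \<phi>
    using charts[OF that] openin_subset[of T V]
      openin_subset[of "subtopology (Euclidean_space d) (sector d k)" "\<phi> ` V"]
    by (auto simp: corner_chart_def)
  note V = chart_facts[OF chart]
  have "i < d" using V(1) i by simp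
  have VT: "topspace (subtopology T V) = V" using V(3) by auto
  have inj: "inj_on \<phi> V"
    using V(5) VT unfolding homeomorphic_eq_everything_map by metis
  define p where "p = \<phi> x"
  have p: "p \<in> \<phi> ` V" "p i = 0" using x i by (auto simp: p_def)
  obtain N where N: "openin (Euclidean_space d) N" "\<phi> ` V = N \<inter> sector d k"
    using V(4) by (auto simp: openin_subtopology)
  have "\<forall>\<^sub>F t in nhds (p i). p(i := t) \<in> N"
    using eventually_line_in_open[OF N(1) _ \<open>i < d\<close>, of p] p N(2) by auto
  then obtain \<epsilon> where \<epsilon>: "0 < \<epsilon>" and N\<epsilon>: "\<And>t. dist t 0 < \<epsilon> \<Longrightarrow> p(i := t) \<in> N"
    unfolding eventually_nhds_metric p(2) by blast
  have p_sector: "p \<in> sector d k" using p V(6) by blast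
  \<comment> \<open>Raising the coordinate \<open>i\<close> keeps the point in the sector, whatever its other coordinates are.\<close>
  have arc: "p(i := \<epsilon> * t) \<in> \<phi> ` V" if "0 \<le> t" "t < 1" for t
  proof -
    have "p(i := \<epsilon> * t) \<in> N" using that \<epsilon> by (intro N\<epsilon>) auto
    moreover have "p(i := \<epsilon> * t) \<in> sector d k"
      using p_sector that \<epsilon> \<open>i < d\<close> by (auto simp: sector_def topspace_Euclidean_space)
    ultimately show ?thesis using N(2) by blast
  qed
  define c where "c t = inv_into V \<phi> (p(i := \<epsilon> * t))" for t
  have c: "c t \<in> V" "\<phi> (c t) = p(i := \<epsilon> * t)" if "0 \<le> t" "t < 1" for t
    using arc[OF that] by (auto simp: c_def inv_into_into f_inv_into_f)
  have cont_inv: "continuous_map (subtopology (Euclidean_space d) (\<phi> ` V)) T (inv_into V \<phi>)"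
  proof -
    obtain g where g: "homeomorphic_maps (subtopology T V)
        (subtopology (Euclidean_space d) (\<phi> ` V)) \<phi> g"
      using V(5) homeomorphic_map_maps by blast
    then have "continuous_map (subtopology (Euclidean_space d) (\<phi> ` V)) T g"
      by (auto simp: homeomorphic_maps_def continuous_map_in_subtopology)
    moreover have "g y = inv_into V \<phi> y" if "y \<in> \<phi> ` V" for y
      using g that inj VT by (auto simp: homeomorphic_maps_def)
    ultimately show ?thesis by (auto intro: continuous_map_eq)
  qed
  show ?thesis
  proof (rule not_fibrant_if_half_open_arc)
    show "V \<subseteq> carrier (manifold_diff d T \<A>)" using V(3) by (simp add: manifold_diff_def)
    show "c t \<in> V" "\<phi> (c t) i / \<epsilon> = t" if "0 \<le> t" "t < 1" for t
      using c[OF that] \<epsilon> by auto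
    show "0 \<le> \<phi> a i / \<epsilon>" if "a \<in> V" for a
      using that V(6) i \<epsilon> by (auto simp: sector_def)
    show "openin (Euclidean_space r) {u\<in>U. s u \<in> V}"
      if "openin (Euclidean_space r) U" "s \<in> plots (manifold_diff d T \<A>) r U" for r U s
      using that openin_preimage_on[OF that(1) _ V(2)] by (simp add: manifold_diff_def)
    show "Ck_on j r {u\<in>U. s u \<in> V} (\<lambda>u. \<phi> (s u) i / \<epsilon>)"
      if U: "openin (Euclidean_space r) U" and s: "s \<in> plots (manifold_diff d T \<A>) r U" for r U s j
    proof -
      have "openin (Euclidean_space r) {u\<in>U. s u \<in> V}"
        using s openin_preimage_on[OF U _ V(2)] by (simp add: manifold_diff_def)
      moreover have "smooth_map r {u\<in>U. s u \<in> V} d (\<lambda>u. \<phi> (s u))"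
        using s chart by (auto simp: manifold_diff_def)
      then have "Ck_on j r {u\<in>U. s u \<in> V} (\<lambda>u. \<phi> (s u) i)"
        using \<open>i < d\<close> by (simp add: smooth_map_def)
      ultimately have "Ck_on j r {u\<in>U. s u \<in> V} (\<lambda>u. (1 / \<epsilon>) * \<phi> (s u) i)"
        by (intro Ck_on_mult Ck_on_const)
      then show ?thesis by simp
    qed
    show "(\<lambda>u\<in>U. c (q u)) \<in> plots (manifold_diff d T \<A>) r U"
      if U: "openin (Euclidean_space r) U" and q: "\<And>j. Ck_on j r U q" and q01: "q ` U \<subseteq> {0..<1}"
      for r U q
    proof -
      have q01': "0 \<le> q u" "q u < 1" if "u \<in> U" for u using q01 that by auto
      have Ck\<epsilon>: "Ck_on j r U (\<lambda>u. \<epsilon> * q u)" for j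
        by (intro Ck_on_mult[OF U] Ck_on_const q)
      have cont_arc: "continuous_map (subtopology (Euclidean_space r) U) (Euclidean_space d)
          (\<lambda>u. p(i := \<epsilon> * q u))"
        using continuous_map_compose[OF Ck_on_imp_continuous[OF Ck\<epsilon>]
            continuous_map_fun_upd_Euclidean[of p d i]] p V(7) \<open>i < d\<close>
        by (auto simp: o_def)
      have "continuous_map (subtopology (Euclidean_space r) U)
          (subtopology (Euclidean_space d) (\<phi> ` V)) (\<lambda>u. p(i := \<epsilon> * q u))"
        using cont_arc arc q01' by (auto simp: continuous_map_in_subtopology)
      from continuous_map_compose[OF this cont_inv]
      have cont: "continuous_map (subtopology (Euclidean_space r) U) T (\<lambda>u. c (q u))"
        by (simp add: o_def c_def)
      have smooth: "smooth_map r {u\<in>U. c (q u) \<in> W} d (\<lambda>u. \<psi> (c (q u)))"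
        if ch: "(l, W, \<psi>) \<in> \<A>" for l W \<psi>
        unfolding smooth_map_def
      proof (intro conjI allI impI)
        note W = chart_facts[OF ch]
        show "(\<lambda>u. \<psi> (c (q u))) ` {u\<in>U. c (q u) \<in> W} \<subseteq> topspace (Euclidean_space d)"
          using W(7) by auto
        have trans: "smooth_map_on_subset d (\<phi> ` (V \<inter> W)) d (\<lambda>y. \<psi> (inv_into V \<phi> y))"
          using M chart ch unfolding smooth_manifold_with_corners_def by fastforce
        fix j m assume "j < d"
        show "Ck_on m r {u\<in>U. c (q u) \<in> W} (\<lambda>u. \<psi> (c (q u)) j)"
        proof (rule Ck_on_local)
          show U': "openin (Euclidean_space r) {u\<in>U. c (q u) \<in> W}"
            by (rule openin_preimage_on[OF U cont W(2)])
          fix u0 assume "u0 \<in> {u\<in>U. c (q u) \<in> W}"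
          then have u0: "u0 \<in> U" "c (q u0) \<in> W" by auto
          have "p(i := \<epsilon> * q u0) \<in> \<phi> ` (V \<inter> W)"
            using c[OF q01'[OF u0(1)]] u0(2) by (metis IntI imageI)
          \<comment> \<open>The transition map lives on a set that need not be open; it is replaced by a local smooth extension.\<close>
          then obtain O' G where O': "openin (Euclidean_space d) O'" "p(i := \<epsilon> * q u0) \<in> O'"
            and G: "smooth_map d O' d G"
            and G_eq: "\<And>y. y \<in> O' \<inter> \<phi> ` (V \<inter> W) \<Longrightarrow> G y = \<psi> (inv_into V \<phi> y)"
            using trans unfolding smooth_map_on_subset_def by metis
          let ?N = "{u\<in>{u\<in>U. c (q u) \<in> W}. p(i := \<epsilon> * q u) \<in> O'}"
          have N_sub: "?N \<subseteq> U" by auto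
          have N: "openin (Euclidean_space r) ?N"
            by (rule openin_preimage_on[OF U' _ O'(1)])
              (rule continuous_map_from_subtopology_mono[OF cont_arc], auto)
          have "Ck_on m r ?N (\<lambda>u. G (p(i := \<epsilon> * q u)) j)"
            by (rule Ck_on_compose_fun_upd[where G="\<lambda>y. G y j", OF N O'(1)])
              (use G \<open>j < d\<close> \<open>i < d\<close> Ck_on_subset[OF Ck\<epsilon> N_sub] in
                \<open>auto simp: smooth_map_def\<close>)
          then have "Ck_on m r ?N (\<lambda>u. \<psi> (c (q u)) j)"
          proof (rule Ck_on_cong_imp[OF N, rotated])
            fix u assume "u \<in> ?N"
            then have u: "u \<in> U" "c (q u) \<in> W" "p(i := \<epsilon> * q u) \<in> O'" by auto
            have "p(i := \<epsilon> * q u) \<in> \<phi> ` (V \<inter> W)"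
              using c[OF q01'[OF u(1)]] u(2) by (metis IntI imageI)
            then show "G (p(i := \<epsilon> * q u)) j = \<psi> (c (q u)) j"
              using G_eq u(3) by (simp add: c_def)
          qed
          then show "\<exists>N. openin (Euclidean_space r) N \<and> u0 \<in> N \<and>
              Ck_on m r N (\<lambda>u. \<psi> (c (q u)) j)"
            using N u0 O'(2) by blast
        qed
      qed
      let ?s = "\<lambda>u\<in>U. c (q u)"
      have "smooth_map r {u\<in>U. ?s u \<in> W} d (\<lambda>u. \<psi> (?s u))" if ch: "(l, W, \<psi>) \<in> \<A>" for l W \<psi>
      proof -
        have eq: "{u\<in>U. ?s u \<in> W} = {u\<in>U. c (q u) \<in> W}" by auto
        have U': "openin (Euclidean_space r) {u\<in>U. c (q u) \<in> W}"
          by (rule openin_preimage_on[OF U cont chart_facts(2)[OF ch]])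
        have "Ck_on m r {u\<in>U. c (q u) \<in> W} (\<lambda>u. \<psi> (?s u) j)" if "j < d" for m j
        proof (rule Ck_on_cong_imp[OF U', rotated])
          show "Ck_on m r {u\<in>U. c (q u) \<in> W} (\<lambda>u. \<psi> (c (q u)) j)"
            using smooth[OF ch] that by (simp add: smooth_map_def)
        qed simp
        then show ?thesis
          using smooth[OF ch] unfolding eq by (auto simp: smooth_map_def)
      qed
      moreover have "?s \<in> U \<rightarrow>\<^sub>E topspace T"
        using c(1) q01' V(3) by auto
      moreover have "continuous_map (subtopology (Euclidean_space r) U) T ?s"
        by (rule continuous_map_eq[OF cont]) auto
      ultimately show ?thesis
        by (simp only: manifold_diff_def diff_space.simps mem_Collect_eq) fast
    qed
  qed
qed

theorem corollary4p47:
  fixes n d :: nat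
    and X :: "'a diff_space"
    and T :: "'b topology" and \<A> :: "'b chart set"
  shows "(diffeological_space X \<and>
          (\<exists>A. openin (D_topology X) A \<and> diffeomorphic (sub_diffeology X A) (half_space n))
            \<longrightarrow> \<not> fibrant X) \<and>
         (smooth_manifold_with_boundary d T \<A> \<and> manifold_boundary \<A> \<noteq> {}
            \<longrightarrow> \<not> fibrant (manifold_diff d T \<A>)) \<and>
         (smooth_manifold_with_corners d T \<A> \<and> manifold_boundary \<A> \<noteq> {}
            \<longrightarrow> \<not> fibrant (manifold_diff d T \<A>))"
  using not_fibrant_if_contains_half_space[of X _ n] not_fibrant_manifold_with_corners[of d T \<A>]
  unfolding smooth_manifold_with_boundary_def by blast

end
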